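(* Let $G$ be a connected graph of order $n\geq 5$ and minimum degree $\delta$. Let $H=K_\delta\vee (K_2\cup K_{n-\delta-2})$; its spectral radius $\rho(H)$ is the largest root of $$\lambda^3 - (n - 3)\lambda^2 - (2\delta+1)\lambda + 2\delta(n-\delta-2)-n+1=0.$$ If $\rho(G) \geq \rho(H)$, then $G$ is super-$\kappa$.
   Context: All graphs are finite, simple and undirected. $\rho(G)$ denotes the spectral radius (largest eigenvalue) of the adjacency matrix of $G$. A vertex-cut of a connected graph is a set of vertices whose removal disconnects it; a minimum vertex-cut is one of minimum size. $G$ is super-connected (super-$\kappa$) if every minimum vertex-cut isolates a vertex of minimum degree (i.e., for every minimum vertex-cut $S$, some component of $G-S$ is a single vertex of degree $\delta(G)$). $K_r$ is the complete graph on $r$ vertices, $\cup$ is disjoint union and $G_1\vee G_2$ is the join (disjoint union plus all edges between $G_1$ and $G_2$).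
   Formalization: The printed constant term 2δ(n-δ-2)-n+1 is wrong (n=5, δ=1 gives largest root 3, but ρ(H)=(1+√17)/2); it is corrected to 2δ(n-δ-2)+n-2δ-3, and the root claim is stated for δ ≤ n-2, where H is defined. *)

theory Defs
  imports "Jordan_Normal_Form.Spectral_Radius"
begin

record 'a graph =
  verts :: "'a set"
  edges :: "'a set set"

definition simple_graph :: "'a graph \<Rightarrow> bool" where
  "simple_graph G \<longleftrightarrow> finite (verts G) \<and> (\<forall>e\<in>edges G. e \<subseteq> verts G \<and> card e = 2)"

definition adj :: "'a graph \<Rightarrow> 'a \<Rightarrow> 'a \<Rightarrow> bool" where
  "adj G u v \<longleftrightarrow> {u, v} \<in> edges G"

definition vdegree :: "'a graph \<Rightarrow> 'a \<Rightarrow> nat" where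
  "vdegree G v = card {u \<in> verts G. adj G v u}"

definition min_degree :: "'a graph \<Rightarrow> nat" where
  "min_degree G = Min (vdegree G ` verts G)"

definition reachable :: "'a graph \<Rightarrow> 'a \<Rightarrow> 'a \<Rightarrow> bool" where
  "reachable G = (adj G)\<^sup>*\<^sup>*"

text \<open>The empty graph counts as connected, so that deleting all vertices does not disconnect.\<close>

definition connected_graph :: "'a graph \<Rightarrow> bool" where
  "connected_graph G \<longleftrightarrow> (\<forall>u\<in>verts G. \<forall>v\<in>verts G. reachable G u v)"

definition components_of :: "'a graph \<Rightarrow> 'a set set" where
  "components_of G = {{u \<in> verts G. reachable G v u} | v. v \<in> verts G}"

definition delete_verts :: "'a graph \<Rightarrow> 'a set \<Rightarrow> 'a graph" where
  "delete_verts G S = \<lparr>verts = verts G - S, edges = {e \<in> edges G. e \<inter> S = {}}\<rparr>"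

definition vertex_cut :: "'a graph \<Rightarrow> 'a set \<Rightarrow> bool" where
  "vertex_cut G S \<longleftrightarrow> S \<subseteq> verts G \<and> \<not> connected_graph (delete_verts G S)"

definition minimum_vertex_cut :: "'a graph \<Rightarrow> 'a set \<Rightarrow> bool" where
  "minimum_vertex_cut G S \<longleftrightarrow>
     vertex_cut G S \<and> (\<forall>T. vertex_cut G T \<longrightarrow> card S \<le> card T)"

text \<open>A complete graph has no vertex-cut and is therefore super-connected.\<close>

definition super_connected :: "'a graph \<Rightarrow> bool" where
  "super_connected G \<longleftrightarrow>
     (\<forall>S. minimum_vertex_cut G S \<longrightarrow>
        (\<exists>v. {v} \<in> components_of (delete_verts G S) \<and> vdegree G v = min_degree G))"

definition complete_graph :: "nat \<Rightarrow> nat graph" where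
  "complete_graph r = \<lparr>verts = {..<r}, edges = {e. e \<subseteq> {..<r} \<and> card e = 2}\<rparr>"

definition graph_union :: "'a graph \<Rightarrow> 'b graph \<Rightarrow> ('a + 'b) graph" where
  "graph_union G H = \<lparr>verts = verts G <+> verts H,
     edges = (`) Inl ` edges G \<union> (`) Inr ` edges H\<rparr>"

definition graph_join :: "'a graph \<Rightarrow> 'b graph \<Rightarrow> ('a + 'b) graph" where
  "graph_join G H = \<lparr>verts = verts G <+> verts H,
     edges = edges (graph_union G H) \<union> {{Inl u, Inr v} | u v. u \<in> verts G \<and> v \<in> verts H}\<rparr>"

definition adj_matrix :: "'a graph \<Rightarrow> 'a list \<Rightarrow> complex mat" where
  "adj_matrix G vs = mat (length vs) (length vs) (\<lambda>(i, j). if adj G (vs ! i) (vs ! j) then 1 else 0)"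

text \<open>
  The spectrum does not depend on the enumeration of the vertices: two enumerations give
  permutation-similar matrices. As the matrix is symmetric and nonnegative, the largest modulus
  of an eigenvalue, taken by \<^const>\<open>spectral_radius\<close>, is the largest eigenvalue.
\<close>

definition graph_spectral_radius :: "'a graph \<Rightarrow> real" where
  "graph_spectral_radius G =
     spectral_radius (adj_matrix G (SOME vs. distinct vs \<and> set vs = verts G))"

definition is_largest_root :: "(real \<Rightarrow> real) \<Rightarrow> real \<Rightarrow> bool" where
  "is_largest_root f r \<longleftrightarrow> f r = 0 \<and> (\<forall>x. f x = 0 \<longrightarrow> x \<le> r)"

end

theory Submission
  imports Defs
begin

text \<open>
  If \<open>y > 0\<close> satisfies \<open>A y \<le> \<lambda> y\<close> for the adjacency matrix \<open>A\<close> of a connected graph, with strict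
  inequality at some vertex, then the spectral radius is below \<open>\<lambda>\<close>: the moduli \<open>x = |z|\<close> of an
  eigenvector for an eigenvalue of maximal modulus \<open>\<rho>\<close> satisfy \<open>A x \<ge> \<rho> x\<close>, and pairing \<open>x\<close> with \<open>y\<close>
  gives \<open>\<rho> \<le> \<lambda>\<close>; equality would make \<open>x\<close> an eigenvector vanishing at the strict vertex, hence
  everywhere by connectedness.

  If \<open>G\<close> is not super-connected, a minimum cut \<open>S\<close> has at most \<open>\<delta>\<close> vertices and splits the rest into
  two sides of size at least 2. Moving vertices of the sides into \<open>S\<close> gives a separator of size
  exactly \<open>\<delta>\<close> with sides of sizes \<open>a, b\<close>, \<open>a + b = n - \<delta>\<close> and \<open>(a - 2) (b - 2) \<ge> 0\<close>. With
  \<open>\<lambda> = \<rho>(H)\<close>, the vector \<open>y\<close> equal to 1 on the separator and to \<open>\<delta> / (\<lambda> - a + 1)\<close> and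
  \<open>\<delta> / (\<lambda> - b + 1)\<close> on the sides satisfies \<open>A y \<le> \<lambda> y\<close>, because the defect on the separator is
  governed by \<open>a b - 2 (a + b - 2) = (a - 2) (b - 2)\<close>.
\<close>

section \<open>Adjacency eigenvalues in terms of functions on the vertices\<close>

definition nbrs :: "'a graph \<Rightarrow> 'a \<Rightarrow> 'a set" where
  "nbrs G v = {u \<in> verts G. adj G v u}"

lemma adj_sym: "adj G u v \<longleftrightarrow> adj G v u"
  by (simp add: adj_def insert_commute)

lemma simple_graph_adjD:
  assumes "simple_graph G" "adj G u v"
  shows "u \<in> verts G" "v \<in> verts G" "u \<noteq> v"
  using assms by (auto simp: simple_graph_def adj_def)

lemma finite_nbrs [simp]: "simple_graph G \<Longrightarrow> finite (nbrs G v)"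
  by (simp add: nbrs_def simple_graph_def)

text \<open>Row \<open>i\<close> of the matrix sums a vector over the neighbours of
  \<open>vs ! i\<close>, and \<open>(!) vs\<close> is a bijection onto the vertices. The right-hand
  side no longer mentions \<open>vs\<close>, so later arguments are free of matrices and
  enumerations.\<close>

lemma eigenvalue_adj_matrix_iff:
  assumes "distinct vs" "set vs = verts G"
  shows "eigenvalue (adj_matrix G vs) k \<longleftrightarrow>
    (\<exists>x. (\<exists>v\<in>verts G. x v \<noteq> 0) \<and> (\<forall>v\<in>verts G. (\<Sum>u\<in>nbrs G v. x u) = k * x v))"
    (is "?L \<longleftrightarrow> ?R")
proof -
  define n where "n = length vs"
  have bij: "bij_betw ((!) vs) {0..<n} (verts G)"
    using bij_betw_nth[OF assms(1) refl assms(2)[symmetric]] by (simp add: n_def atLeast0LessThan)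
  have fin: "finite (verts G)"
    using assms(2) by (metis List.finite_set)
  have "(adj_matrix G vs *\<^sub>v vec n (\<lambda>i. x (vs ! i))) $ i = (\<Sum>u\<in>nbrs G (vs ! i). x u)"
    if "i < n" for x i
  proof -
    have "(adj_matrix G vs *\<^sub>v vec n (\<lambda>i. x (vs ! i))) $ i
        = (\<Sum>j = 0..<n. (if adj G (vs ! i) (vs ! j) then x (vs ! j) else 0))"
      using that by (auto simp: adj_matrix_def n_def scalar_prod_def intro!: sum.cong)
    also have "\<dots> = (\<Sum>u\<in>verts G. (if adj G (vs ! i) u then x u else 0))"
      by (rule sum.reindex_bij_betw[OF bij])
    also have "\<dots> = (\<Sum>u\<in>nbrs G (vs ! i). x u)"
      using fin by (simp add: nbrs_def sum.inter_filter)
    finally show ?thesis .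
  qed
  note mult = this
  have carrier: "adj_matrix G vs \<in> carrier_mat n n"
    by (simp add: adj_matrix_def n_def)
  have verts_iff: "(\<forall>v\<in>verts G. P v) \<longleftrightarrow> (\<forall>i<n. P (vs ! i))" for P
    using assms(2) by (metis n_def in_set_conv_nth)
  have eig: "eigenvector (adj_matrix G vs) (vec n (\<lambda>i. x (vs ! i))) k \<longleftrightarrow>
     (\<exists>v\<in>verts G. x v \<noteq> 0) \<and> (\<forall>v\<in>verts G. (\<Sum>u\<in>nbrs G v. x u) = k * x v)" for x
  proof -
    have "vec n (\<lambda>i. x (vs ! i)) = 0\<^sub>v n \<longleftrightarrow> (\<forall>v\<in>verts G. x v = 0)"
      unfolding verts_iff by (auto simp: vec_eq_iff)
    moreover have "adj_matrix G vs *\<^sub>v vec n (\<lambda>i. x (vs ! i)) = k \<cdot>\<^sub>v vec n (\<lambda>i. x (vs ! i))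
        \<longleftrightarrow> (\<forall>v\<in>verts G. (\<Sum>u\<in>nbrs G v. x u) = k * x v)"
      unfolding verts_iff vec_eq_iff using mult carrier by auto
    ultimately show ?thesis
      using carrier by (auto simp: eigenvector_def)
  qed
  show ?thesis
  proof
    assume ?L
    then obtain w where w: "eigenvector (adj_matrix G vs) w k"
      by (auto simp: eigenvalue_def)
    define x where "x = (\<lambda>v. w $ (inv_into {0..<n} ((!) vs) v))"
    have "x (vs ! i) = w $ i" if "i < n" for i
      using bij that by (simp add: x_def bij_betw_def inv_into_f_f)
    moreover have "w \<in> carrier_vec n"
      using w carrier by (auto simp: eigenvector_def)
    ultimately have "w = vec n (\<lambda>i. x (vs ! i))"
      by auto
    with w eig show ?R by metis
  next
    assume ?R
    with eig show ?L by (metis eigenvalue_def)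
  qed
qed

text \<open>The maximal modulus is attained by some eigenvalue and bounds all of them. A finite
  vertex set has a distinct enumeration, so the choice by \<open>SOME\<close> is meaningful.\<close>

lemma graph_spectral_radius_bounds:
  assumes "simple_graph G" "verts G \<noteq> {}"
  shows "\<exists>x k. graph_spectral_radius G = norm (k :: complex) \<and> (\<exists>v\<in>verts G. x v \<noteq> 0) \<and>
      (\<forall>v\<in>verts G. (\<Sum>u\<in>nbrs G v. x u) = k * x v)"
    and "\<And>x k. \<exists>v\<in>verts G. x v \<noteq> 0 \<Longrightarrow>
      (\<forall>v\<in>verts G. (\<Sum>u\<in>nbrs G v. x u) = k * x v) \<Longrightarrow> norm (k :: complex) \<le> graph_spectral_radius G"
proof -
  define vs where "vs = (SOME vs. distinct vs \<and> set vs = verts G)"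
  have "\<exists>vs. distinct vs \<and> set vs = verts G"
    using assms(1) finite_distinct_list[of "verts G"] by (auto simp: simple_graph_def)
  then have vs: "distinct vs" "set vs = verts G"
    unfolding vs_def by (metis (mono_tags, lifting) someI_ex)+
  have \<rho>: "graph_spectral_radius G = spectral_radius (adj_matrix G vs)"
    by (simp add: graph_spectral_radius_def vs_def)
  have car: "adj_matrix G vs \<in> carrier_mat (length vs) (length vs)"
    by (simp add: adj_matrix_def)
  have "0 < length vs"
    using vs assms(2) by auto
  note mem_max = spectral_radius_mem_max[OF car this]
  show "\<exists>x k. graph_spectral_radius G = norm (k :: complex) \<and> (\<exists>v\<in>verts G. x v \<noteq> 0) \<and>
      (\<forall>v\<in>verts G. (\<Sum>u\<in>nbrs G v. x u) = k * x v)"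
  proof -
    obtain k where "eigenvalue (adj_matrix G vs) k" "graph_spectral_radius G = norm k"
      using mem_max(1) unfolding \<rho> by (auto simp: spectrum_def)
    then show ?thesis
      unfolding eigenvalue_adj_matrix_iff[OF vs] by blast
  qed
  show "norm k \<le> graph_spectral_radius G"
    if "\<exists>v\<in>verts G. x v \<noteq> 0" "\<forall>v\<in>verts G. (\<Sum>u\<in>nbrs G v. x u) = k * x v" for x and k :: complex
  proof -
    have "eigenvalue (adj_matrix G vs) k"
      unfolding eigenvalue_adj_matrix_iff[OF vs] using that by blast
    then show ?thesis
      unfolding \<rho> by (intro mem_max(2)) (simp add: spectrum_def)
  qed
qed

section \<open>Comparison of the spectral radius with positive test vectors\<close>

lemma sum_nbrs_swap:
  fixes x y :: "'a \<Rightarrow> real"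
  assumes "simple_graph G"
  shows "(\<Sum>v\<in>verts G. y v * (\<Sum>u\<in>nbrs G v. x u)) = (\<Sum>v\<in>verts G. x v * (\<Sum>u\<in>nbrs G v. y u))"
proof -
  have fin: "finite (verts G)"
    using assms by (simp add: simple_graph_def)
  have expand: "(\<Sum>v\<in>verts G. y v * (\<Sum>u\<in>nbrs G v. x u))
      = (\<Sum>v\<in>verts G. \<Sum>u\<in>verts G. if adj G v u then y v * x u else 0)" for x y :: "'a \<Rightarrow> real"
    using fin by (simp add: nbrs_def sum.inter_filter sum_distrib_left if_distrib cong: if_cong)
  show ?thesis
    unfolding expand by (subst sum.swap) (simp add: adj_sym mult.commute cong: if_cong)
qed

text \<open>The defects of \<open>x\<close>, weighted by \<open>y\<close>, and those of
  \<open>y\<close>, weighted by \<open>x\<close>, are nonnegative. By symmetry of the adjacency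
  relation their total is \<open>l - m\<close> times the positive inner product of \<open>x\<close>
  and \<open>y\<close>. For \<open>m = l\<close> every single defect must vanish.\<close>

lemma subinvariant_vector:
  fixes x y :: "'a \<Rightarrow> real"
  assumes G: "simple_graph G"
    and y: "\<forall>v\<in>verts G. y v > 0"
    and Ay: "\<forall>v\<in>verts G. (\<Sum>u\<in>nbrs G v. y u) \<le> l * y v"
    and x: "\<forall>v\<in>verts G. x v \<ge> 0" "\<exists>v\<in>verts G. x v \<noteq> 0"
    and Ax: "\<forall>v\<in>verts G. m * x v \<le> (\<Sum>u\<in>nbrs G v. x u)"
  shows "m \<le> l"
    and "m = l \<Longrightarrow> v \<in> verts G \<Longrightarrow> (\<Sum>u\<in>nbrs G v. x u) = l * x v"
    and "m = l \<Longrightarrow> v \<in> verts G \<Longrightarrow> x v > 0 \<Longrightarrow> (\<Sum>u\<in>nbrs G v. y u) = l * y v"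
proof -
  have fin: "finite (verts G)"
    using G by (simp add: simple_graph_def)
  let ?X = "\<lambda>v. y v * ((\<Sum>u\<in>nbrs G v. x u) - m * x v)"
  let ?Y = "\<lambda>v. x v * (l * y v - (\<Sum>u\<in>nbrs G v. y u))"
  have X0: "?X v \<ge> 0" and Y0: "?Y v \<ge> 0" if "v \<in> verts G" for v
    using y Ay x(1) Ax that by (simp_all add: less_imp_le)
  have key: "(\<Sum>v\<in>verts G. ?X v) + (\<Sum>v\<in>verts G. ?Y v) = (l - m) * (\<Sum>v\<in>verts G. x v * y v)"
    using sum_nbrs_swap[OF G, of y x]
    by (simp add: right_diff_distrib left_diff_distrib sum_subtractf sum_distrib_left algebra_simps)
  obtain w where w: "w \<in> verts G" "x w > 0"
    using x by force
  have "(\<Sum>v\<in>verts G. x v * y v) > 0"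
    using w y x(1) by (intro sum_pos2[OF fin w(1)]) (simp_all add: less_imp_le)
  moreover have "0 \<le> (\<Sum>v\<in>verts G. ?X v)" "0 \<le> (\<Sum>v\<in>verts G. ?Y v)"
    using X0 Y0 by (auto intro!: sum_nonneg)
  ultimately show "m \<le> l"
    using key by (smt (verit, ccfv_SIG) mult_neg_pos)
  assume eq: "m = l" and v: "v \<in> verts G"
  have "(\<Sum>v\<in>verts G. ?X v) = 0" "(\<Sum>v\<in>verts G. ?Y v) = 0"
    using key eq \<open>0 \<le> (\<Sum>v\<in>verts G. ?X v)\<close> \<open>0 \<le> (\<Sum>v\<in>verts G. ?Y v)\<close> by simp_all
  then have "?X v = 0" "?Y v = 0"
    using sum_nonneg_eq_0_iff[OF fin, of ?X] sum_nonneg_eq_0_iff[OF fin, of ?Y] X0 Y0 v by blast+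
  then show "(\<Sum>u\<in>nbrs G v. x u) = l * x v"
    and "x v > 0 \<Longrightarrow> (\<Sum>u\<in>nbrs G v. y u) = l * y v"
    using y v eq by fastforce+
qed

text \<open>At a zero of \<open>x\<close> the sum over the neighbours is zero; its terms are
  nonnegative, so all neighbours are zeros as well. Induction along a path does the rest.\<close>

lemma zero_propagates:
  fixes x :: "'a \<Rightarrow> real"
  assumes G: "simple_graph G" "connected_graph G"
    and x: "\<And>v. v \<in> verts G \<Longrightarrow> x v \<ge> 0"
    and Ax: "\<And>v. v \<in> verts G \<Longrightarrow> (\<Sum>u\<in>nbrs G v. x u) = l * x v"
    and w: "w \<in> verts G" "x w = 0" and v: "v \<in> verts G"
  shows "x v = 0"
proof -
  have "reachable G w v"
    using G(2) w v by (simp add: connected_graph_def)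
  then show ?thesis
    unfolding reachable_def
  proof (induction rule: rtranclp_induct)
    case base
    then show ?case using w by simp
  next
    case (step u t)
    have ut: "u \<in> verts G" "t \<in> nbrs G u"
      using simple_graph_adjD[OF G(1) step(2)] step(2) by (auto simp: nbrs_def)
    have "(\<Sum>t\<in>nbrs G u. x t) = 0"
      using Ax[OF ut(1)] step.IH by simp
    then show ?case
      using sum_nonneg_eq_0_iff[OF finite_nbrs[OF G(1)], of u x] x ut by (auto simp: nbrs_def)
  qed
qed

lemma graph_spectral_radius_le:
  fixes y :: "'a \<Rightarrow> real"
  assumes G: "simple_graph G" "verts G \<noteq> {}"
    and y: "\<And>v. v \<in> verts G \<Longrightarrow> y v > 0"
    and Ay: "\<And>v. v \<in> verts G \<Longrightarrow> (\<Sum>u\<in>nbrs G v. y u) \<le> l * y v"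
  shows "graph_spectral_radius G \<le> l"
    and "connected_graph G \<Longrightarrow> w \<in> verts G \<Longrightarrow> (\<Sum>u\<in>nbrs G w. y u) < l * y w \<Longrightarrow>
      graph_spectral_radius G < l"
proof -
  obtain x k where k: "graph_spectral_radius G = norm (k :: complex)"
    and x0: "\<exists>v\<in>verts G. x v \<noteq> 0"
    and x: "\<And>v. v \<in> verts G \<Longrightarrow> (\<Sum>u\<in>nbrs G v. x u) = k * x v"
    using graph_spectral_radius_bounds(1)[OF G] by blast
  \<comment> \<open>The triangle inequality, applied to the eigenvalue equation.\<close>
  have Ax: "\<forall>v\<in>verts G. norm k * norm (x v) \<le> (\<Sum>u\<in>nbrs G v. norm (x u))"
    using norm_sum by (metis x norm_mult)
  have nz: "\<exists>v\<in>verts G. norm (x v) \<noteq> 0"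
    using x0 by simp
  have "\<forall>v\<in>verts G. y v > 0" "\<forall>v\<in>verts G. (\<Sum>u\<in>nbrs G v. y u) \<le> l * y v"
    "\<forall>v\<in>verts G. norm (x v) \<ge> 0"
    using y Ay by simp_all
  note sub = subinvariant_vector[OF G(1) this nz Ax]
  show "graph_spectral_radius G \<le> l"
    using sub(1) k by simp
  assume con: "connected_graph G" and w: "w \<in> verts G" "(\<Sum>u\<in>nbrs G w. y u) < l * y w"
  have "norm k \<noteq> l"
  proof
    assume eq: "norm k = l"
    have w0: "norm (x w) = 0"
      using sub(3)[OF eq w(1)] w(2) by fastforce
    have "norm (x v) = 0" if "v \<in> verts G" for v
      by (rule zero_propagates[OF G(1) con norm_ge_zero sub(2)[OF eq] w(1) w0 that])
    with x0 show False by simp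
  qed
  then show "graph_spectral_radius G < l"
    using sub(1) k by simp
qed

text \<open>A positive eigenvector is a test vector for the upper bound, and its eigenvalue is
  itself a lower bound.\<close>

lemma graph_spectral_radius_eqI:
  fixes y :: "'a \<Rightarrow> real"
  assumes G: "simple_graph G" "verts G \<noteq> {}"
    and y: "\<And>v. v \<in> verts G \<Longrightarrow> y v > 0"
    and Ay: "\<And>v. v \<in> verts G \<Longrightarrow> (\<Sum>u\<in>nbrs G v. y u) = l * y v"
  shows "graph_spectral_radius G = l"
proof (rule antisym)
  show "graph_spectral_radius G \<le> l"
    using graph_spectral_radius_le(1)[OF G y] Ay by (simp add: less_imp_le)
  have "\<exists>v\<in>verts G. complex_of_real (y v) \<noteq> 0"
    using G(2) y by fastforce
  moreover have "\<forall>v\<in>verts G. (\<Sum>u\<in>nbrs G v. complex_of_real (y u)) = of_real l * of_real (y v)"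
    using Ay by (metis of_real_mult of_real_sum)
  ultimately have "norm (complex_of_real l) \<le> graph_spectral_radius G"
    by (rule graph_spectral_radius_bounds(2)[OF G])
  then show "l \<le> graph_spectral_radius G"
    by simp
qed


section \<open>Neighbourhoods in complete graphs, unions and joins\<close>

lemma image_edge_iff:
  assumes "inj f"
  shows "{f u, f v} \<in> (`) f ` E \<longleftrightarrow> {u, v} \<in> E"
proof -
  have "f ` {u, v} \<in> (`) f ` E \<longleftrightarrow> {u, v} \<in> E"
    using assms by (intro inj_image_mem_iff injI) (simp add: inj_image_eq_iff)
  then show ?thesis by simp
qed

lemma Inl_Inr_edge_simps [simp]:
  "{Inl u, Inl v} \<in> (`) Inl ` E \<longleftrightarrow> {u, v} \<in> E"
  "{Inr u', Inr v'} \<in> (`) Inr ` E' \<longleftrightarrow> {u', v'} \<in> E'"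
  "{Inl u, x} \<notin> (`) Inr ` E'" "{x, Inl u} \<notin> (`) Inr ` E'"
  "{Inr u', x} \<notin> (`) Inl ` E" "{x, Inr u'} \<notin> (`) Inl ` E"
  by (auto simp: image_edge_iff)

lemma adj_graph_union [simp]:
  "adj (graph_union G H) (Inl u) (Inl v) = adj G u v"
  "adj (graph_union G H) (Inr u') (Inr v') = adj H u' v'"
  "\<not> adj (graph_union G H) (Inl u) (Inr v')"
  "\<not> adj (graph_union G H) (Inr u') (Inl v)"
  by (simp_all add: adj_def graph_union_def)

lemma adj_graph_join [simp]:
  "adj (graph_join G H) (Inl u) (Inl v) = adj G u v"
  "adj (graph_join G H) (Inr u') (Inr v') = adj H u' v'"
  "adj (graph_join G H) (Inl u) (Inr v') \<longleftrightarrow> u \<in> verts G \<and> v' \<in> verts H"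
  "adj (graph_join G H) (Inr u') (Inl v) \<longleftrightarrow> v \<in> verts G \<and> u' \<in> verts H"
  by (auto simp: adj_def graph_join_def graph_union_def doubleton_eq_iff)

lemma verts_graph_union [simp]: "verts (graph_union G H) = verts G <+> verts H"
  and verts_graph_join [simp]: "verts (graph_join G H) = verts G <+> verts H"
  and verts_complete_graph [simp]: "verts (complete_graph r) = {..<r}"
  by (simp_all add: graph_union_def graph_join_def complete_graph_def)

lemma nbrs_complete_graph: "i < r \<Longrightarrow> nbrs (complete_graph r) i = {..<r} - {i}"
  by (auto simp: nbrs_def adj_def complete_graph_def card_2_iff doubleton_eq_iff)

lemma Inl_in_Plus [simp]: "Inl a \<in> A <+> B \<longleftrightarrow> a \<in> A"
  and Inr_in_Plus [simp]: "Inr b \<in> A <+> B \<longleftrightarrow> b \<in> B"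
  by auto

lemma nbrs_graph_union:
  "nbrs (graph_union G H) (Inl u) = nbrs G u <+> {}"
  "nbrs (graph_union G H) (Inr v) = {} <+> nbrs H v"
  by (auto simp: nbrs_def)

lemma nbrs_graph_join:
  "u \<in> verts G \<Longrightarrow> nbrs (graph_join G H) (Inl u) = nbrs G u <+> verts H"
  "v \<in> verts H \<Longrightarrow> nbrs (graph_join G H) (Inr v) = verts G <+> nbrs H v"
  by (auto simp: nbrs_def)

lemma simple_graph_complete_graph: "simple_graph (complete_graph r)"
  by (simp add: simple_graph_def complete_graph_def)

lemma simple_graph_union:
  assumes "simple_graph G" "simple_graph H"
  shows "simple_graph (graph_union G H)"
proof -
  have fin: "finite (verts G <+> verts H)"
    using assms by (simp add: simple_graph_def)
  have Inl: "Inl ` e \<subseteq> verts G <+> verts H \<and> card (Inl ` e) = 2" if "e \<in> edges G" for e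
    using assms(1) that by (auto simp: simple_graph_def card_image)
  have Inr: "Inr ` e \<subseteq> verts G <+> verts H \<and> card (Inr ` e) = 2" if "e \<in> edges H" for e
    using assms(2) that by (auto simp: simple_graph_def card_image)
  have "e \<subseteq> verts G <+> verts H \<and> card e = 2" if e: "e \<in> edges (graph_union G H)" for e
  proof -
    consider e' where "e' \<in> edges G" "e = Inl ` e'" | e' where "e' \<in> edges H" "e = Inr ` e'"
      using e by (auto simp: graph_union_def)
    then show ?thesis
      by cases (use Inl Inr in blast)+
  qed
  with fin show ?thesis
    by (simp add: simple_graph_def)
qed

lemma simple_graph_join:
  assumes "simple_graph G" "simple_graph H"
  shows "simple_graph (graph_join G H)"
proof -
  have "{Inl u, Inr v} \<subseteq> verts G <+> verts H \<and> card {Inl u, Inr v} = 2"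
    if "u \<in> verts G" "v \<in> verts H" for u v
    using that by simp
  moreover have "edges (graph_join G H) = edges (graph_union G H)
      \<union> {{Inl u, Inr v} | u v. u \<in> verts G \<and> v \<in> verts H}"
    by (simp add: graph_join_def)
  ultimately show ?thesis
    using simple_graph_union[OF assms] by (auto simp: simple_graph_def)
qed

section \<open>The spectral radius of \<open>H\<close> as a root of a cubic\<close>

text \<open>
  The characteristic polynomial of the quotient matrix of \<open>K\<^sub>d \<or> (K\<^sub>2 \<union> K\<^sub>m)\<close> with respect to its
  three blocks. Expanded, its constant term is \<open>2 d m + m - d - 1\<close>, which is
  \<open>2 d (n - d - 2) + n - 2 d - 3\<close> for \<open>n = d + m + 2\<close>.
\<close>

definition quot_poly :: "real \<Rightarrow> real \<Rightarrow> real \<Rightarrow> real" where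
  "quot_poly d m x = (x - d + 1) * (x - 1) * (x - m + 1) - 2 * d * (x - m + 1) - m * d * (x - 1)"

text \<open>The eigenvector is constant on each of the three blocks. The lower bounds on
  \<open>x\<close> make its entries positive, which identifies \<open>x\<close> as the spectral
  radius and not merely an eigenvalue.\<close>

lemma graph_spectral_radius_H:
  assumes d: "d \<ge> 1" and x: "x > 1" "x > real m - 1" and root: "quot_poly d m x = 0"
  shows "graph_spectral_radius
    (graph_join (complete_graph d) (graph_union (complete_graph 2) (complete_graph m))) = x"
    (is "graph_spectral_radius ?H = x")
proof -
  define y where "y = case_sum (\<lambda>_ :: nat. 1 :: real)
      (case_sum (\<lambda>_ :: nat. d / (x - 1)) (\<lambda>_ :: nat. d / (x - m + 1)))"
  show ?thesis
  proof (rule graph_spectral_radius_eqI)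
    show "simple_graph ?H"
      by (intro simple_graph_join simple_graph_union simple_graph_complete_graph)
    show "verts ?H \<noteq> {}"
      by (simp add: lessThan_empty_iff)
    show "y v > 0" if "v \<in> verts ?H" for v
      using d x that by (auto simp: y_def)
    show "(\<Sum>u\<in>nbrs ?H v. y u) = x * y v" if v: "v \<in> verts ?H" for v
    proof -
      \<comment> \<open>The eigenvalue equation on the block \<open>K_d\<close> is the root
        condition divided by \<open>(x - 1) * (x - m + 1)\<close>; on the other two blocks it holds
        by the choice of the entries of \<open>y\<close>.\<close>
      have "real d - 1 + 2 * (d / (x - 1)) + m * (d / (x - m + 1)) = x"
        using x root by (simp add: quot_poly_def divide_simps) (simp add: algebra_simps)
      moreover have "d + d / (x - 1) = x * (d / (x - 1))"
        "d + (real m - 1) * (d / (x - m + 1)) = x * (d / (x - m + 1))"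
        using x by (simp_all add: divide_simps) (simp_all add: algebra_simps)
      moreover have "real (d - 1) = real d - 1"
        using d by simp
      ultimately show ?thesis
        using v d
        by (auto simp: y_def nbrs_graph_join nbrs_graph_union nbrs_complete_graph sum.Plus
            card_Diff_singleton of_nat_diff)
    qed
  qed
qed

lemma quot_poly_root_exists:
  assumes "d \<ge> 1"
  obtains x where "quot_poly (real d) (real m) x = 0" "x > real m + real d - 1"
proof -
  \<comment> \<open>\<open>c\<close> is the spectral radius of the subgraph \<open>K_(d+m)\<close>
    of \<open>H\<close>, and \<open>c + 2 = n - 1\<close> is that of \<open>K_n\<close>; the cubic
    changes sign between them.\<close>
  define c where "c = real m + real d - 1"
  have "quot_poly d m c = - 2 * real d * real d"
    by (simp add: quot_poly_def c_def algebra_simps)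
  also have "\<dots> < 0"
    using assms by simp
  finally have neg: "quot_poly d m c < 0" .
  have "quot_poly d m (c + 2) = 4 * real m * d + 2 * real m * m + 4 * real m"
    by (simp add: quot_poly_def c_def algebra_simps)
  then have nonneg: "quot_poly d m (c + 2) \<ge> 0"
    by simp
  have "\<exists>x\<ge>c. x \<le> c + 2 \<and> quot_poly d m x = 0"
    using neg nonneg by (intro IVT) (auto simp: quot_poly_def intro!: continuous_intros)
  then obtain x where "x \<ge> c" "quot_poly d m x = 0"
    by blast
  moreover from this have "x \<noteq> c"
    using neg by auto
  ultimately show ?thesis
    using that[of x] by (simp add: c_def)
qed

section \<open>Test vectors for a separator with two sides\<close>

text \<open>This is the test inequality at a separator vertex. With denominators cleared and
  \<open>a + b\<close> fixed, it depends on the sides only through \<open>a * b\<close>; the sides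
  \<open>2\<close> and \<open>m\<close> give \<open>quot_poly\<close>, and
  \<open>a * b - 2 * m = (a - 2) * (b - 2)\<close>.\<close>

lemma quot_poly_balance:
  fixes a b d l m :: real
  assumes root: "quot_poly d m l = 0"
    and ab: "a + b = m + 2" "(a - 2) * (b - 2) \<ge> 0"
    and l: "l > a - 1" "l > b - 1" and d: "d \<ge> 0" "l + 1 > 0"
  shows "d - 1 + a * (d / (l - a + 1)) + b * (d / (l - b + 1)) \<le> l"
proof -
  have b: "b = m + 2 - a"
    using ab(1) by simp
  have "(l - d + 1) * (l - a + 1) * (l - b + 1) - a * d * (l - b + 1) - b * d * (l - a + 1)
      = quot_poly d m l + (a - 2) * (b - 2) * (l + 1 + d)"
    by (simp add: quot_poly_def b algebra_simps)
  also have "\<dots> \<ge> 0"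
    using root ab(2) d by simp
  finally show ?thesis
    using l by (simp add: divide_simps) (simp add: algebra_simps)
qed

text \<open>\<open>G\<close> lies in the graph that has all edges except those between
  \<open>A\<close> and \<open>B\<close>, and \<open>y\<close> is a test vector for that graph. The
  pair \<open>w\<close>, \<open>z\<close> is an edge of it missing from \<open>G\<close>, which
  makes the inequality strict at \<open>w\<close>.\<close>

lemma graph_spectral_radius_less_partition:
  fixes l :: real
  assumes G: "simple_graph G" "connected_graph G"
    and V: "verts G = S \<union> A \<union> B" and disj: "S \<inter> A = {}" "S \<inter> B = {}" "A \<inter> B = {}"
    and AB: "\<And>u v. u \<in> A \<Longrightarrow> v \<in> B \<Longrightarrow> \<not> adj G u v"
    and S: "card S > 0" and l: "l > real (card A) - 1" "l > real (card B) - 1"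
    and bal: "real (card S) - 1 + card A * (card S / (l - card A + 1))
        + card B * (card S / (l - card B + 1)) \<le> l"
    and wz: "w \<in> verts G" "z \<in> verts G" "w \<noteq> z" "\<not> adj G w z"
      "\<not> (w \<in> A \<and> z \<in> B)" "\<not> (w \<in> B \<and> z \<in> A)"
  shows "graph_spectral_radius G < l"
proof -
  have fin: "finite S" "finite A" "finite B"
    using G(1) V by (auto simp: simple_graph_def)
  define q where "q = card S / (l - card A + 1)"
  define r where "r = card S / (l - card B + 1)"
  define y where "y v = (if v \<in> S then 1 else if v \<in> A then q else r)" for v
  \<comment> \<open>\<open>F v\<close> is the neighbourhood of \<open>v\<close> in the larger
    graph.\<close>
  define F where "F v = (if v \<in> S then S \<union> A \<union> B else if v \<in> A then S \<union> A else S \<union> B) - {v}" for v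
  \<comment> \<open>\<open>q\<close> and \<open>r\<close> are chosen so that the eigenvalue equation
    of the larger graph holds exactly on \<open>A\<close> and on \<open>B\<close>.\<close>
  have q: "q > 0" "card S + card A * q - q = l * q"
    using S l(1) by (simp_all add: q_def divide_simps) (simp add: algebra_simps)
  have r: "r > 0" "card S + card B * r - r = l * r"
    using S l(2) by (simp_all add: r_def divide_simps) (simp add: algebra_simps)
  have "sum y S = card S"
    by (simp add: y_def)
  moreover have "sum y A = card A * q"
    using disj by (subst sum.cong[OF refl, of A y "\<lambda>_. q"]) (auto simp: y_def)
  moreover have "sum y B = card B * r"
    using disj by (subst sum.cong[OF refl, of B y "\<lambda>_. r"]) (auto simp: y_def)
  ultimately have sums: "sum y (S \<union> A \<union> B) = card S + card A * q + card B * r"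
      "sum y (S \<union> A) = card S + card A * q" "sum y (S \<union> B) = card S + card B * r"
    using fin disj by (simp_all add: sum.union_disjoint Int_Un_distrib2)
  have pos: "y v > 0" for v
    using q(1) r(1) by (simp add: y_def)
  have sumF: "sum y (F v) \<le> l * y v" if v: "v \<in> verts G" for v
  proof -
    consider "v \<in> S" | "v \<in> A" "v \<notin> S" | "v \<in> B" "v \<notin> S" "v \<notin> A"
      using v V by blast
    then show ?thesis
    proof cases
      case 1
      then have "sum y (F v) = sum y (S \<union> A \<union> B) - 1"
        using fin by (simp add: F_def sum_diff1 y_def)
      then show ?thesis
        using bal 1 sums by (simp add: y_def q_def r_def)
    next
      case 2
      then have "sum y (F v) = sum y (S \<union> A) - q"
        using fin by (simp add: F_def sum_diff1 y_def)
      then show ?thesis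
        using q 2 sums by (simp add: y_def)
    next
      case 3
      then have "sum y (F v) = sum y (S \<union> B) - r"
        using fin by (simp add: F_def sum_diff1 y_def)
      then show ?thesis
        using r 3 sums by (simp add: y_def)
    qed
  qed
  have finF: "finite (F v)" for v
    using fin by (simp add: F_def)
  have sub: "nbrs G v \<subseteq> F v" if "v \<in> verts G" for v
  proof
    fix u assume "u \<in> nbrs G v"
    then have "u \<in> verts G" "adj G v u" "adj G u v" "u \<noteq> v"
      using simple_graph_adjD(3)[OF G(1)] by (auto simp: nbrs_def adj_sym)
    then show "u \<in> F v"
      using that AB disj unfolding V F_def by auto
  qed
  have z: "z \<in> F w - nbrs G w"
    using wz unfolding V F_def nbrs_def by auto
  show ?thesis
  proof (rule graph_spectral_radius_le(2))
    show "verts G \<noteq> {}"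
      using wz(1) by auto
    show "sum y (nbrs G v) \<le> l * y v" if "v \<in> verts G" for v
      using sum_mono2[OF finF sub[OF that], of y] sumF[OF that] pos by (simp add: less_imp_le)
    have "sum y (nbrs G w) < sum y (F w)"
      using sub[OF wz(1)] z pos by (intro sum_strict_mono2[OF finF]) (auto intro: less_imp_le)
    then show "sum y (nbrs G w) < l * y w"
      using sumF[OF wz(1)] by linarith
  qed (use G wz(1) pos in auto)
qed

section \<open>Minimum degree and vertex-cuts\<close>

lemma vdegree_eq_card_nbrs: "vdegree G v = card (nbrs G v)"
  by (simp add: vdegree_def nbrs_def)

lemma min_degree_le: "simple_graph G \<Longrightarrow> v \<in> verts G \<Longrightarrow> min_degree G \<le> card (nbrs G v)"
  by (simp add: min_degree_def vdegree_eq_card_nbrs simple_graph_def)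

lemma min_degree_attained:
  assumes "simple_graph G" "verts G \<noteq> {}"
  obtains v where "v \<in> verts G" "card (nbrs G v) = min_degree G"
proof -
  have "min_degree G \<in> vdegree G ` verts G"
    using assms by (simp add: min_degree_def simple_graph_def)
  then show ?thesis
    using that by (auto simp: vdegree_eq_card_nbrs)
qed

lemma verts_delete_verts [simp]: "verts (delete_verts G S) = verts G - S"
  and adj_delete_verts [simp]: "adj (delete_verts G S) u v \<longleftrightarrow> adj G u v \<and> u \<notin> S \<and> v \<notin> S"
  by (auto simp: delete_verts_def adj_def)

text \<open>A nontrivial path from \<open>v\<close> would have to start with a deleted
  neighbour.\<close>

lemma reachable_delete_nbrs:
  assumes "simple_graph G" "nbrs G v \<subseteq> S" "reachable (delete_verts G S) v x"
  shows "x = v"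
  using assms(3) unfolding reachable_def
proof (cases rule: converse_rtranclpE)
  case (step y)
  then have "adj G v y" "y \<notin> S" by simp_all
  with assms(2) simple_graph_adjD(2)[OF assms(1), of v y] show ?thesis
    by (auto simp: nbrs_def)
qed simp

lemma singleton_component:
  assumes "simple_graph G" "nbrs G v \<subseteq> S" "v \<in> verts G - S"
  shows "{v} \<in> components_of (delete_verts G S)"
proof -
  have "{v} = {u \<in> verts G - S. reachable (delete_verts G S) v u}"
    using reachable_delete_nbrs[OF assms(1,2)] assms(3) by (auto simp: reachable_def)
  then show ?thesis
    using assms(3) by (auto simp: components_of_def)
qed

lemma vertex_cut_sides:
  assumes G: "simple_graph G" and cut: "vertex_cut G S"
  obtains A B where "verts G = S \<union> A \<union> B" "S \<inter> A = {}" "S \<inter> B = {}" "A \<inter> B = {}"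
    "A \<noteq> {}" "B \<noteq> {}" "\<And>u v. u \<in> A \<Longrightarrow> v \<in> B \<Longrightarrow> \<not> adj G u v"
proof -
  let ?D = "delete_verts G S"
  obtain u w where uw: "u \<in> verts G - S" "w \<in> verts G - S" "\<not> reachable ?D u w"
    using cut by (auto simp: vertex_cut_def connected_graph_def)
  \<comment> \<open>One component of the remaining graph; \<open>B\<close> collects all the others
    and need not be connected.\<close>
  define A where "A = {x \<in> verts G - S. reachable ?D u x}"
  define B where "B = verts G - S - A"
  show ?thesis
  proof (rule that)
    show "verts G = S \<union> A \<union> B"
      using cut by (auto simp: A_def B_def vertex_cut_def)
    have "u \<in> A" "w \<in> B"
      using uw by (auto simp: A_def B_def reachable_def)
    then show "A \<noteq> {}" "B \<noteq> {}" by auto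
    show "\<not> adj G x y" if "x \<in> A" "y \<in> B" for x y
    proof
      assume "adj G x y"
      then have "adj ?D x y"
        using that by (auto simp: A_def B_def)
      then have "reachable ?D u y"
        using that(1) by (auto simp: A_def reachable_def intro: rtranclp.rtrancl_into_rtrancl)
      then show False
        using that(2) by (auto simp: A_def B_def)
    qed
  qed (auto simp: A_def B_def)
qed

text \<open>The neighbourhood of a vertex of minimum degree is itself a vertex-cut, provided some
  vertex lies outside the closed neighbourhood. A non-adjacent pair on opposite sides of
  \<open>S\<close> bounds the minimum degree by two less than the order, so such a vertex
  exists.\<close>

lemma minimum_vertex_cut_card_le_min_degree:
  assumes G: "simple_graph G" and cut: "minimum_vertex_cut G S"
  shows "card S \<le> min_degree G"
proof -
  have "vertex_cut G S"
    using cut by (simp add: minimum_vertex_cut_def)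
  from vertex_cut_sides[OF G this] obtain A B where AB: "verts G = S \<union> A \<union> B"
    "A \<inter> B = {}" "A \<noteq> {}" "B \<noteq> {}" "\<And>u v. u \<in> A \<Longrightarrow> v \<in> B \<Longrightarrow> \<not> adj G u v"
    by metis
  obtain u w where uw: "u \<in> A" "w \<in> B"
    using AB by blast
  have fin: "finite (verts G)"
    using G by (simp add: simple_graph_def)
  have V: "verts G \<noteq> {}"
    using AB by auto
  obtain v where v: "v \<in> verts G" "card (nbrs G v) = min_degree G"
    using min_degree_attained[OF G V] .
  have uw': "u \<noteq> w" "{u, w} \<subseteq> verts G"
    using uw AB by auto
  have "nbrs G u \<subseteq> verts G - {u, w}"
    using simple_graph_adjD(3)[OF G] AB(5) uw by (auto simp: nbrs_def)
  then have "card (nbrs G u) \<le> card (verts G - {u, w})"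
    using fin by (intro card_mono) auto
  also have "\<dots> = card (verts G) - 2"
    using uw' by (subst card_Diff_subset) auto
  finally have "min_degree G \<le> card (verts G) - 2"
    using min_degree_le[OF G, of u] uw AB(1) by auto
  moreover have "card (verts G) \<ge> 2"
    using card_mono[OF fin uw'(2)] uw'(1) by simp
  moreover have "card (insert v (nbrs G v)) \<le> min_degree G + 1"
    using v(2) card_insert_if[OF finite_nbrs[OF G], of v v] by simp
  ultimately have "card (insert v (nbrs G v)) < card (verts G)"
    by linarith
  then obtain x where x: "x \<in> verts G" "x \<notin> insert v (nbrs G v)"
    using card_mono[of "insert v (nbrs G v)" "verts G"] G by (metis finite_insert finite_nbrs leD subsetI)
  have "v \<notin> nbrs G v"
    using simple_graph_adjD(3)[OF G] by (auto simp: nbrs_def)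
  moreover have "\<not> reachable (delete_verts G (nbrs G v)) v x"
    using reachable_delete_nbrs[OF G subset_refl] x by auto
  ultimately have "vertex_cut G (nbrs G v)"
    using v(1) x by (auto simp: vertex_cut_def connected_graph_def nbrs_def)
  then show ?thesis
    using cut v(2) by (auto simp: minimum_vertex_cut_def)
qed

text \<open>A vertex of \<open>A\<close> has all its neighbours in \<open>S\<close> and the rest of
  \<open>A\<close>. If it were alone in \<open>A\<close>, its degree would be at most
  \<open>card S\<close>, hence minimum, and \<open>S\<close> would isolate it.\<close>

lemma min_degree_le_side:
  assumes G: "simple_graph G" and V: "verts G = S \<union> A \<union> B"
    and AB: "\<And>u v. u \<in> A \<Longrightarrow> v \<in> B \<Longrightarrow> \<not> adj G u v" and "A \<noteq> {}" and disj: "S \<inter> A = {}"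
  shows "min_degree G + 1 \<le> card S + card A"
    and "card S \<le> min_degree G \<Longrightarrow>
      \<not> (\<exists>v. {v} \<in> components_of (delete_verts G S) \<and> vdegree G v = min_degree G) \<Longrightarrow> 2 \<le> card A"
proof -
  have fin: "finite S" "finite A"
    using G V by (auto simp: simple_graph_def)
  have nbrs: "nbrs G v \<subseteq> S \<union> A - {v}" if "v \<in> A" for v
    using that AB simple_graph_adjD(3)[OF G] unfolding nbrs_def V by auto
  obtain u where u: "u \<in> A"
    using assms(4) by blast
  have "min_degree G \<le> card (nbrs G u)"
    using min_degree_le[OF G] u V by auto
  also have "\<dots> \<le> card (S \<union> A - {u})"
    using nbrs[OF u] fin by (intro card_mono) auto
  also have "\<dots> = card S + card A - 1"
    using u fin disj by (simp add: card_Un_disjoint)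
  finally have "min_degree G \<le> card S + card A - 1" .
  moreover have "card A > 0"
    using u fin by (auto simp: card_gt_0_iff)
  ultimately show "min_degree G + 1 \<le> card S + card A"
    by linarith
  assume le: "card S \<le> min_degree G"
    and no: "\<not> (\<exists>v. {v} \<in> components_of (delete_verts G S) \<and> vdegree G v = min_degree G)"
  show "2 \<le> card A"
  proof (rule ccontr)
    assume "\<not> 2 \<le> card A"
    moreover have "card A > 0"
      using u fin by (auto simp: card_gt_0_iff)
    ultimately have "card A = 1" by linarith
    then have "A = {u}"
      using u by (auto simp: card_1_singleton_iff)
    then have sub: "nbrs G u \<subseteq> S"
      using nbrs[OF u] by auto
    then have "card (nbrs G u) \<le> card S"
      using fin by (intro card_mono)
    then have "vdegree G u = min_degree G"
      using le \<open>min_degree G \<le> card (nbrs G u)\<close> by (simp add: vdegree_eq_card_nbrs)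
    moreover have "{u} \<in> components_of (delete_verts G S)"
      using singleton_component[OF G sub] u disj V by auto
    ultimately show False
      using no by blast
  qed
qed

text \<open>A path from a vertex of minimum degree to any other vertex has a first edge.\<close>

lemma connected_min_degree_pos:
  assumes G: "simple_graph G" "connected_graph G" "card (verts G) \<ge> 2"
  shows "min_degree G \<ge> 1"
proof -
  have "verts G \<noteq> {}"
    using G(3) by auto
  then obtain v where v: "v \<in> verts G" "card (nbrs G v) = min_degree G"
    using min_degree_attained[OF G(1)] by blast
  have "verts G \<noteq> {v}"
    using G(3) by auto
  then obtain u where u: "u \<in> verts G" "u \<noteq> v"
    using v by blast
  have "reachable G v u"
    using G(2) u v by (simp add: connected_graph_def)
  then obtain t where "adj G v t"
    unfolding reachable_def using u(2) by (metis converse_rtranclpE)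
  then have "t \<in> nbrs G v"
    using simple_graph_adjD[OF G(1)] by (auto simp: nbrs_def)
  then have "card (nbrs G v) > 0"
    using finite_nbrs[OF G(1)] by (auto simp: card_gt_0_iff)
  with v(2) show ?thesis by simp
qed

section \<open>Graphs that are not super-connected\<close>

text \<open>Removes \<open>t\<close> vertices from the two sides without emptying either. A single
  vertex comes from the larger side, so that a side of size 2 keeps its factor zero; for
  \<open>t \<ge> 2\<close> one vertex comes from the first side and \<open>t - 1\<close> from the
  second, leaving both sizes at least 2.\<close>

lemma shrink_sides:
  fixes a b t :: nat
  assumes "a \<ge> 2" "b \<ge> 2" "a \<ge> t + 1" "b \<ge> t + 1"
  obtains a' b' where "1 \<le> a'" "a' \<le> a" "1 \<le> b'" "b' \<le> b" "a' + b' + t = a + b"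
    "(real a' - 2) * (real b' - 2) \<ge> 0"
proof -
  consider "t = 0" | "t = 1" "a \<le> b" | "t = 1" "b \<le> a" | "t \<ge> 2"
    by linarith
  then show ?thesis
  proof cases
    case 1
    then show ?thesis using assms by (intro that[of a b]) auto
  next
    case 2
    then show ?thesis using assms
      by (intro that[of a "b - 1"]) (auto simp: of_nat_diff zero_le_mult_iff)
  next
    case 3
    then show ?thesis using assms
      by (intro that[of "a - 1" b]) (auto simp: of_nat_diff zero_le_mult_iff)
  next
    case 4
    then show ?thesis using assms
      by (intro that[of "a - 1" "b - (t - 1)"]) (auto simp: of_nat_diff zero_le_mult_iff)
  qed
qed

lemma not_super_connected_sides:
  assumes G: "simple_graph G" and "\<not> super_connected G"
  obtains S A B where "verts G = S \<union> A \<union> B" "S \<inter> A = {}" "S \<inter> B = {}" "A \<inter> B = {}"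
    "\<forall>u\<in>A. \<forall>v\<in>B. \<not> adj G u v" "card S \<le> min_degree G"
    "2 \<le> card A" "2 \<le> card B"
    "min_degree G + 1 \<le> card S + card A" "min_degree G + 1 \<le> card S + card B"
proof -
  obtain S where cut: "minimum_vertex_cut G S"
    and no: "\<not> (\<exists>v. {v} \<in> components_of (delete_verts G S) \<and> vdegree G v = min_degree G)"
    using assms(2) by (auto simp: super_connected_def)
  note S = minimum_vertex_cut_card_le_min_degree[OF G cut]
  have "vertex_cut G S"
    using cut by (simp add: minimum_vertex_cut_def)
  from vertex_cut_sides[OF G this] obtain A B where AB: "verts G = S \<union> A \<union> B"
    "S \<inter> A = {}" "S \<inter> B = {}" "A \<inter> B = {}"
    "A \<noteq> {}" "B \<noteq> {}" "\<And>u v. u \<in> A \<Longrightarrow> v \<in> B \<Longrightarrow> \<not> adj G u v"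
    by metis
  \<comment> \<open>The bounds for \<open>B\<close> come from the same lemma with the two sides
    exchanged.\<close>
  have BA: "\<And>u v. u \<in> B \<Longrightarrow> v \<in> A \<Longrightarrow> \<not> adj G u v" "verts G = S \<union> B \<union> A"
    using AB(7) adj_sym[of G] AB(1) by (metis, blast)
  show ?thesis
    by (rule that[OF AB(1-4) _ S])
      (use AB(7) min_degree_le_side[OF G AB(1,7,5,2)] min_degree_le_side[OF G BA(2,1) AB(6,3)] S no
        in simp_all)
qed

lemma not_super_connected_card:
  assumes G: "simple_graph G" and "\<not> super_connected G"
  shows "min_degree G + 3 \<le> card (verts G)"
proof -
  obtain S A B where *: "verts G = S \<union> A \<union> B" "S \<inter> A = {}" "S \<inter> B = {}" "A \<inter> B = {}"
    "2 \<le> card A" "2 \<le> card B" "min_degree G + 1 \<le> card S + card A"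
    using not_super_connected_sides[OF assms] by metis
  have "finite S" "finite A" "finite B"
    using G *(1) by (auto simp: simple_graph_def)
  then have "card (verts G) = card S + card A + card B"
    using * by (simp add: card_Un_disjoint Int_Un_distrib2)
  then show ?thesis
    using * by simp
qed

lemma not_super_connected_spectral_radius_less:
  fixes l :: real
  assumes G: "simple_graph G" "connected_graph G"
    and n: "card (verts G) = min_degree G + 2 + m" and pos: "min_degree G \<ge> 1"
    and l: "quot_poly (min_degree G) m l = 0" "l > real m + real (min_degree G) - 1"
    and not_super: "\<not> super_connected G"
  shows "graph_spectral_radius G < l"
proof -
  define d where "d = min_degree G"
  obtain S A B where V: "verts G = S \<union> A \<union> B" and disj: "S \<inter> A = {}" "S \<inter> B = {}" "A \<inter> B = {}"
    and AB: "\<forall>u\<in>A. \<forall>v\<in>B. \<not> adj G u v" and S: "card S \<le> d"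
    and two: "2 \<le> card A" "2 \<le> card B"
    and big: "d + 1 \<le> card S + card A" "d + 1 \<le> card S + card B"
    using not_super_connected_sides[OF G(1) not_super, folded d_def] .
  have fin: "finite S" "finite A" "finite B"
    using G(1) V by (auto simp: simple_graph_def)
  have cardV: "card (verts G) = card S + card A + card B"
    using fin disj by (simp add: V card_Un_disjoint Int_Un_distrib2)
  \<comment> \<open>The number of vertices to be moved into the separator to bring it to size
    \<open>d\<close>. The bounds \<open>big\<close> say that each side has at least
    \<open>t + 1\<close> vertices.\<close>
  define t where "t = d - card S"
  have t: "t + card S = d"
    using S by (simp add: t_def)
  obtain a b where ab: "1 \<le> a" "a \<le> card A" "1 \<le> b" "b \<le> card B" "a + b + t = card A + card B"
    "(real a - 2) * (real b - 2) \<ge> 0"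
    using shrink_sides[of "card A" "card B" t] two big t by auto
  obtain A' where A': "A' \<subseteq> A" "card A' = a"
    using obtain_subset_with_card_n[OF ab(2)] by metis
  obtain B' where B': "B' \<subseteq> B" "card B' = b"
    using obtain_subset_with_card_n[OF ab(4)] by metis
  define S' where "S' = verts G - (A' \<union> B')"
  have fin': "finite A'" "finite B'"
    using A' B' fin finite_subset by auto
  have "A' \<inter> B' = {}" "A' \<union> B' \<subseteq> verts G"
    using A'(1) B'(1) disj V by auto
  then have cardS': "card S' = card (verts G) - (a + b)"
    using fin' A'(2) B'(2) by (simp add: S'_def card_Diff_subset card_Un_disjoint)
  have abm: "a + b = m + 2" "card S' = d"
    using cardS' ab(5) cardV n t by (simp_all flip: d_def)
  txt \<open>
    Strictness: if nothing was moved, a vertex of minimum degree misses a neighbour within its own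
    part; otherwise a moved vertex is not adjacent to the side it did not come from.
  \<close>
  have "\<exists>w z. w \<in> verts G \<and> z \<in> verts G \<and> w \<noteq> z \<and> \<not> adj G w z \<and>
      \<not> (w \<in> A' \<and> z \<in> B') \<and> \<not> (w \<in> B' \<and> z \<in> A')"
  proof (cases "t = 0")
    case True
    then have eq: "A' = A" "B' = B"
      using ab(2,4,5) A' B' fin by (simp_all add: card_subset_eq)
    have "verts G \<noteq> {}"
      using cardV two by auto
    then obtain w where w: "w \<in> verts G" "card (nbrs G w) = d"
      using min_degree_attained[OF G(1)] unfolding d_def by blast
    \<comment> \<open>Here \<open>card S = d\<close> and both sides have at least two vertices, so
      \<open>F\<close> has at least \<open>d + 1\<close> elements, more than the degree of
      \<open>w\<close>. For \<open>w\<close> in \<open>S\<close> either side would serve.\<close>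
    define F where "F = (if w \<in> B then S \<union> B else S \<union> A) - {w}"
    have "d + 1 \<le> card F"
      using w(1) fin disj two True t V
      by (auto simp: F_def card_Diff_singleton_if card_Un_disjoint)
    then have "\<not> F \<subseteq> nbrs G w"
      using card_mono[OF finite_nbrs[OF G(1)], of F w] w(2) by auto
    then obtain z where z: "z \<in> F" "z \<notin> nbrs G w"
      by blast
    then have "z \<in> verts G" "\<not> adj G w z" "w \<noteq> z" "\<not> (w \<in> A \<and> z \<in> B)" "\<not> (w \<in> B \<and> z \<in> A)"
      using V disj by (auto simp: F_def nbrs_def split: if_splits)
    then show ?thesis
      using w(1) unfolding eq by blast
  next
    case False
    then have "\<not> S' \<subseteq> S"
      using card_mono[OF fin(1), of S'] abm(2) t by auto
    then obtain w where w: "w \<in> S'" "w \<notin> S"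
      by blast
    obtain x y where xy: "x \<in> A'" "y \<in> B'"
      using A'(2) B'(2) ab(1,3) by (metis card.empty ex_in_conv not_one_le_zero)
    have wV: "w \<in> verts G" "w \<notin> A'" "w \<notin> B'"
      using w by (auto simp: S'_def)
    show ?thesis
    proof (cases "w \<in> A")
      case True
      then have "\<not> adj G w y" "y \<in> verts G" "w \<noteq> y"
        using AB xy(2) B'(1) V wV by auto
      then show ?thesis
        using wV by blast
    next
      case False
      then have "w \<in> B"
        using wV V w by auto
      then have "\<not> adj G w x" "x \<in> verts G" "w \<noteq> x"
        using AB xy(1) A'(1) V wV adj_sym[of G w x] by auto
      then show ?thesis
        using wV by blast
    qed
  qed
  then obtain w z where wz: "w \<in> verts G" "z \<in> verts G" "w \<noteq> z" "\<not> adj G w z"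
      "\<not> (w \<in> A' \<and> z \<in> B')" "\<not> (w \<in> B' \<and> z \<in> A')"
    by blast
  \<comment> \<open>Each side is nonempty and \<open>a + b = m + 2\<close>, so each has at most
    \<open>m + 1\<close> vertices, while \<open>l > m\<close> because the minimum degree is
    positive.\<close>
  have la: "l > real (card A') - 1" "l > real (card B') - 1"
    using l(2) abm ab(1,3) pos A'(2) B'(2) by linarith+
  show ?thesis
  proof (rule graph_spectral_radius_less_partition[OF G _ _ _ _ _ _ la _ wz])
    show "verts G = S' \<union> A' \<union> B'" "S' \<inter> A' = {}" "S' \<inter> B' = {}"
      using A'(1) B'(1) V by (auto simp: S'_def)
    show "A' \<inter> B' = {}" by fact
    show "\<not> adj G u v" if "u \<in> A'" "v \<in> B'" for u v
      using AB that A'(1) B'(1) by blast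
    show "card S' > 0"
      using pos abm(2) by (simp add: d_def)
    show "real (card S') - 1 + card A' * (card S' / (l - card A' + 1))
        + card B' * (card S' / (l - card B' + 1)) \<le> l"
    proof (rule quot_poly_balance)
      show "quot_poly (card S') m l = 0"
        using l(1) abm(2) by (simp add: d_def)
      show "real (card A') + real (card B') = real m + 2"
        using abm(1) A'(2) B'(2) by linarith
      show "(real (card A') - 2) * (real (card B') - 2) \<ge> 0"
        using ab(6) A'(2) B'(2) by simp
      show "l + 1 > 0"
        using l(2) pos by linarith
    qed (use la in auto)
  qed
qed

theorem theorem4p3:
  fixes G :: "'a graph" and H :: "(nat + (nat + nat)) graph" and n \<delta> :: nat
  assumes "simple_graph G" and "connected_graph G"
    and "card (verts G) = n" and "n \<ge> 5" and "min_degree G = \<delta>"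
    and "H = graph_join (complete_graph \<delta>)
               (graph_union (complete_graph 2) (complete_graph (n - \<delta> - 2)))"
  shows "(\<delta> + 2 \<le> n \<longrightarrow>
            is_largest_root
              (\<lambda>x. x ^ 3 - (real n - 3) * x ^ 2 - (2 * real \<delta> + 1) * x
                    + 2 * real \<delta> * (real n - real \<delta> - 2) + real n - 2 * real \<delta> - 3)
              (graph_spectral_radius H))
         \<and> (graph_spectral_radius G \<ge> graph_spectral_radius H \<longrightarrow> super_connected G)"
proof (cases "\<delta> + 2 \<le> n")
  case True
  define m where "m = n - \<delta> - 2"
  have n: "n = \<delta> + 2 + m"
    using True by (simp add: m_def)
  have H: "H = graph_join (complete_graph \<delta>) (graph_union (complete_graph 2) (complete_graph m))"
    by (simp add: assms(6) m_def)
  have \<delta>: "\<delta> \<ge> 1"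
    using connected_min_degree_pos[OF assms(1,2)] assms(3-5) by simp
  \<comment> \<open>The identity fixes the constant term: \<open>1 - n\<close> in place of
    \<open>n - 2 * \<delta> - 3\<close> would change it by \<open>2 * m\<close>.\<close>
  have poly: "x ^ 3 - (real n - 3) * x ^ 2 - (2 * real \<delta> + 1) * x
      + 2 * real \<delta> * (real n - real \<delta> - 2) + real n - 2 * real \<delta> - 3 = quot_poly \<delta> m x" for x
    by (simp add: n quot_poly_def algebra_simps power2_eq_square power3_eq_cube)
  \<comment> \<open>From \<open>n \<ge> 5\<close> follows \<open>m + \<delta> \<ge> 3\<close>, so
    such a root exceeds 1, as positivity of the eigenvector demands.\<close>
  have \<rho>: "graph_spectral_radius H = x" if "quot_poly \<delta> m x = 0" "x > real m + real \<delta> - 1" for x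
    unfolding H by (rule graph_spectral_radius_H[OF \<delta>]) (use that \<delta> assms(4) n in auto)
  obtain l where l: "quot_poly \<delta> m l = 0" "l > real m + real \<delta> - 1"
    using quot_poly_root_exists[OF \<delta>, of m] by auto
  \<comment> \<open>A root above \<open>m + \<delta> - 1\<close> equals the spectral radius of
    \<open>H\<close>, as \<open>l\<close> does; any other root is at most that threshold, which lies
    below \<open>l\<close>.\<close>
  have "x \<le> l" if "quot_poly \<delta> m x = 0" for x
    using \<rho>[OF that] \<rho>[OF l] l(2) by force
  then have "is_largest_root (\<lambda>x. quot_poly \<delta> m x) (graph_spectral_radius H)"
    using \<rho>[OF l] l(1) by (simp add: is_largest_root_def)
  moreover have "super_connected G" if "graph_spectral_radius G \<ge> graph_spectral_radius H"
    using not_super_connected_spectral_radius_less[OF assms(1,2), of m l]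
      that \<rho>[OF l] l assms(3,5) \<delta> n by force
  ultimately show ?thesis
    unfolding poly by blast
next
  case False
  \<comment> \<open>A graph that is not super-connected has at least \<open>\<delta> + 3\<close>
    vertices, so \<open>G\<close> is super-connected whatever its spectral radius.\<close>
  then show ?thesis
    using not_super_connected_card[OF assms(1)] assms(3,5) by auto
qed

end
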